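(* Let $n\ge 1$ and let $d$ be a positive integer with $d\le n$. The number of $d$-cycles in the graph $G(n,312)$ is $$\frac{1}{d}\sum_{e\mid d}\mu\!\left(\frac{d}{e}\right)\binom{2e}{e},$$ where the sum is over the positive divisors $e$ of $d$ and $\mu$ is the number-theoretic Möbius function.
   Context: For a sequence $x=x_1\cdots x_m$ of distinct real numbers, its standardization $\Pi(x)$ is the unique permutation $\pi\in\mathfrak S_m$ with $\pi_i<\pi_j \iff x_i<x_j$ for all $i,j$. A permutation $\pi\in\mathfrak S_m$ avoids $312$ if there are no indices $i<j<k$ with $\pi_j<\pi_k<\pi_i$; $\mathfrak S_m(312)$ denotes the set of such permutations. The graph $G(n,312)$ is the directed multigraph with vertex set $\mathfrak S_n(312)$ having, for each $\sigma=\sigma_1\cdots\sigma_{n+1}\in\mathfrak S_{n+1}(312)$, one directed edge labelled $\sigma$ from $\Pi(\sigma_1\cdots\sigma_n)$ (its tail) to $\Pi(\sigma_2\cdots\sigma_{n+1})$ (its head). A closed walk of length $d$ is a list of $d$ edges $(e_1,\dots,e_d)$ with $\mathrm{head}(e_i)=\mathrm{tail}(e_{i+1})$ for $1\le i\le d-1$ and $\mathrm{head}(e_d)=\mathrm{tail}(e_1)$; different cyclic shifts of a closed walk are considered different closed walks. Two closed walks are equivalent if one is a cyclic shift $(e_i,\dots,e_d,e_1,\dots,e_{i-1})$ of the other. A $d$-cycle is an equivalence class (of closed walks of length $d$) having exactly $d$ elements. *)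

theory Defs
  imports Complex_Main "HOL-Computational_Algebra.Squarefree" "HOL-Computational_Algebra.Primes"
begin

definition moebius :: "nat \<Rightarrow> int" where
  "moebius n = (if squarefree n then (-1) ^ card (prime_factors n) else 0)"

definition std :: "'a::linorder list \<Rightarrow> nat list" where
  "std xs = map (\<lambda>x. card {y \<in> set xs. y \<le> x}) xs"

definition is_perm :: "nat \<Rightarrow> nat list \<Rightarrow> bool" where
  "is_perm m \<pi> \<longleftrightarrow> length \<pi> = m \<and> distinct \<pi> \<and> set \<pi> = {1..m}"

definition avoids312 :: "nat list \<Rightarrow> bool" where
  "avoids312 \<pi> \<longleftrightarrow> \<not> (\<exists>i j k. i < j \<and> j < k \<and> k < length \<pi> \<and>
       \<pi> ! j < \<pi> ! k \<and> \<pi> ! k < \<pi> ! i)"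

definition S312 :: "nat \<Rightarrow> nat list set" where
  "S312 m = {\<pi>. is_perm m \<pi> \<and> avoids312 \<pi>}"

text \<open>Graph G(n,312): edges are (labelled by) the elements of S312 (n+1).\<close>
definition edge_tail :: "nat list \<Rightarrow> nat list" where
  "edge_tail \<sigma> = std (butlast \<sigma>)"

definition edge_head :: "nat list \<Rightarrow> nat list" where
  "edge_head \<sigma> = std (tl \<sigma>)"

definition closed_walks :: "nat \<Rightarrow> nat \<Rightarrow> nat list list set" where
  "closed_walks n d = {ws. length ws = d \<and> (\<forall>i<d. ws ! i \<in> S312 (n+1)) \<and>
      (\<forall>i. i + 1 < d \<longrightarrow> edge_head (ws ! i) = edge_tail (ws ! (i+1))) \<and>
      (0 < d \<longrightarrow> edge_head (ws ! (d-1)) = edge_tail (ws ! 0))}"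

definition shift_class :: "'a list \<Rightarrow> 'a list set" where
  "shift_class ws = {rotate k ws | k. True}"

definition d_cycles :: "nat \<Rightarrow> nat \<Rightarrow> nat list list set set" where
  "d_cycles n d = {C. \<exists>ws \<in> closed_walks n d. C = shift_class ws \<and> card C = d}"

end

theory Submission
  imports Defs "HOL-Library.FuncSet"
begin

text \<open>
  A closed walk of length d unrolls to a d-periodic bi-infinite sequence of overlapping windows,
  the window at k covering the positions k - n, ..., k of the integers. By 312-avoidance the
  positions of a window that exceed its last entry form a block of some length l k directly before
  it; the numbers l k determine the walk, and the admissible l are those whose blocks of length
  less than n are nested or disjoint. Let r k be the number of positions j whose first smaller
  position to the right is k. Each j is counted at most once, so r has sum at most d over a period.
  Conversely, given such an r, let h be a path with steps h k - h (k - 1) = 1 - r k; the block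
  before k extends back to the nearest position of strictly smaller height, or has length n if
  there is none. Hence closed walks of length d are equinumerous with the d-tuples of natural numbers
  with sum at most d, of which there are (2d choose d), and Moebius inversion extracts the
  aperiodic ones.
\<close>

subsection \<open>Periodic sequences\<close>

definition periodic :: "nat \<Rightarrow> (int \<Rightarrow> 'a) \<Rightarrow> bool" where
  "periodic d f \<longleftrightarrow> (\<forall>k. f (k + int d) = f k)"

lemma periodicD: "periodic d f \<Longrightarrow> f (k + int d) = f k"
  by (simp add: periodic_def)

lemma periodic_mult:
  assumes "periodic d f"
  shows "f (k + int d * m) = f k"
proof (induction m rule: int_induct[where k = 0])
  case (step1 i)
  then show ?case
    using periodicD[OF assms, of "k + int d * i"] by (simp add: algebra_simps)
next
  case (step2 i)
  then show ?case
    using periodicD[OF assms, of "k + int d * (i - 1)"] by (simp add: algebra_simps)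
qed simp

lemma periodic_mod:
  assumes "periodic d f"
  shows "f (k mod int d) = f k"
  using periodic_mult[OF assms, of "k mod int d" "k div int d"] by simp

definition unroll :: "'a list \<Rightarrow> int \<Rightarrow> 'a" where
  "unroll xs k = xs ! nat (k mod int (length xs))"

lemma unroll_nth: "i < length xs \<Longrightarrow> unroll xs (int i) = xs ! i"
  by (simp add: unroll_def)

lemma periodic_unroll: "periodic (length xs) (unroll xs)"
  by (simp add: periodic_def unroll_def)

lemma unroll_map:
  assumes "periodic d f" "0 < d"
  shows "unroll (map (\<lambda>i. f (int i)) [0..<d]) = f"
proof
  fix k
  have "nat (k mod int d) < d" using assms(2) by (simp add: nat_less_iff)
  then show "unroll (map (\<lambda>i. f (int i)) [0..<d]) k = f k"
    using assms by (simp add: unroll_def periodic_mod)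
qed

lemma bij_betw_unroll:
  assumes "0 < d"
  shows "bij_betw unroll {xs. length xs = d \<and> P (unroll xs)} {f. periodic d f \<and> P f}"
proof (rule bij_betwI[where g = "\<lambda>f. map (\<lambda>i. f (int i)) [0..<d]"])
  show "unroll \<in> {xs. length xs = d \<and> P (unroll xs)} \<rightarrow> {f. periodic d f \<and> P f}"
    using periodic_unroll by auto
qed (use assms in \<open>auto simp: unroll_map unroll_nth intro!: nth_equalityI\<close>)

text \<open>Prepending the slack \<open>m - sum_list xs\<close> turns the bound into an equality
  with one more entry, which stars and bars counts.\<close>

lemma card_sum_list_le:
  "card {xs :: nat list. length xs = d \<and> sum_list xs \<le> m} = (m + d) choose m"
proof -
  have "bij_betw tl {xs :: nat list. length xs = Suc d \<and> sum_list xs = m}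
    {xs. length xs = d \<and> sum_list xs \<le> m}"
    by (rule bij_betwI[where g = "\<lambda>xs. (m - sum_list xs) # xs"]) (auto simp: length_Suc_conv)
  from bij_betw_same_card[OF this] show ?thesis
    using card_length_sum_list[of "Suc d" m] by simp
qed

lemma sum_unroll: "(\<Sum>k\<in>{0..<int (length xs)}. unroll xs k) = sum_list xs"
proof -
  have "(\<Sum>k\<in>{0..<int (length xs)}. unroll xs k) = (\<Sum>i\<in>{0..<length xs}. unroll xs (int i))"
    by (simp add: image_int_atLeastLessThan[of 0, simplified, symmetric] sum.reindex)
  also have "\<dots> = sum_list xs" by (simp add: sum_list_sum_nth unroll_nth)
  finally show ?thesis .
qed

lemma card_periodic_sum_le:
  assumes "0 < d"
  shows "card {r :: int \<Rightarrow> nat. periodic d r \<and> (\<Sum>k\<in>{0..<int d}. r k) \<le> m} = (m + d) choose m"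
proof -
  have "card {xs. length xs = d \<and> (\<Sum>k\<in>{0..<int d}. unroll xs k) \<le> m} =
      card {r :: int \<Rightarrow> nat. periodic d r \<and> (\<Sum>k\<in>{0..<int d}. r k) \<le> m}"
    by (rule bij_betw_same_card[OF bij_betw_unroll[OF assms]])
  moreover have "{xs. length xs = d \<and> (\<Sum>k\<in>{0..<int d}. unroll xs k) \<le> m} =
      {xs :: nat list. length xs = d \<and> sum_list xs \<le> m}"
    by (auto simp: sum_unroll[symmetric])
  ultimately show ?thesis by (simp add: card_sum_list_le)
qed

section \<open>Least periods\<close>

definition min_period :: "(int \<Rightarrow> 'a) \<Rightarrow> nat" where
  "min_period f = (LEAST e. 0 < e \<and> periodic e f)"

text \<open>The remainder of a period modulo the least one is again a period, hence zero.\<close>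

lemma min_period:
  assumes "0 < d" "periodic d f"
  shows "0 < min_period f" "periodic (min_period f) f" "min_period f dvd d"
proof -
  show pos: "0 < min_period f" and per: "periodic (min_period f) f"
    using LeastI[of "\<lambda>e. 0 < e \<and> periodic e f" d] assms by (auto simp: min_period_def)
  let ?e = "min_period f"
  have "periodic (d mod ?e) f"
    unfolding periodic_def
  proof
    fix k
    have "int d = int (d mod ?e) + int ?e * int (d div ?e)"
      by (metis mod_mult_div_eq of_nat_add of_nat_mult)
    then have "f (k + int d) = f (k + int (d mod ?e) + int ?e * int (d div ?e))"
      by (simp add: add.assoc)
    then show "f (k + int (d mod ?e)) = f k"
      using periodic_mult[OF per] periodicD[OF assms(2)] by simp
  qed
  moreover have "d mod ?e < ?e" using pos by simp
  ultimately have "d mod ?e = 0"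
    using not_less_Least[of "d mod ?e" "\<lambda>e. 0 < e \<and> periodic e f"] by (auto simp: min_period_def)
  then show "?e dvd d" by auto
qed

lemma periodic_dvd:
  assumes "periodic e f" "e dvd d"
  shows "periodic d f"
  using assms periodic_mult[OF assms(1)] by (auto simp: periodic_def elim!: dvdE)

text \<open>Sorting by least period gives the divisor sum that Moebius inversion inverts. The
  conjunct \<open>periodic e f\<close> accompanies \<open>min_period f = e\<close> because
  \<open>min_period\<close> is unspecified for a function without positive period.\<close>

lemma card_periodic_eq_sum_min_period:
  assumes d: "0 < d" and fin: "finite {f \<in> Q. periodic d f}"
  shows "card {f \<in> Q. periodic d f} =
    (\<Sum>e | e dvd d. card {f \<in> Q. periodic e f \<and> min_period f = e})"
proof -
  have "{f \<in> Q. periodic d f} = (\<Union>e\<in>{e. e dvd d}. {f \<in> Q. periodic e f \<and> min_period f = e})"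
    using min_period[OF d] periodic_dvd[of _ _ d] by auto
  also have "card \<dots> = (\<Sum>e | e dvd d. card {f \<in> Q. periodic e f \<and> min_period f = e})"
  proof (rule card_UN_disjoint)
    show "\<forall>e\<in>{e. e dvd d}. finite {f \<in> Q. periodic e f \<and> min_period f = e}"
      using periodic_dvd[of _ _ d] by (auto intro!: finite_subset[OF _ fin])
  qed (use d in auto)
  finally show ?thesis .
qed

subsection \<open>Laminar sequences and their child counts\<close>

text \<open>The value n of l stands for a block that fills the whole window, hence imposes no nesting.\<close>
definition laminar :: "nat \<Rightarrow> (int \<Rightarrow> nat) set" where
  "laminar n = {l. \<forall>k. l k \<le> n \<and>
     (l k < n \<longrightarrow> (\<forall>i. 0 < i \<and> i \<le> l k \<longrightarrow> l (k - int i) + i \<le> l k))}"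

text \<open>With \<open>k - l k, ..., k - 1\<close> as the block of \<open>k\<close>, a child of
  \<open>k\<close> is a position for which the block of \<open>k\<close> is the first one to its
  right that contains it.\<close>

definition children :: "(int \<Rightarrow> nat) \<Rightarrow> int \<Rightarrow> int set" where
  "children l k = {j. k - int (l k) \<le> j \<and> j < k \<and> (\<forall>i. j < i \<and> i < k \<longrightarrow> j < i - int (l i))}"

definition nchildren :: "(int \<Rightarrow> nat) \<Rightarrow> int \<Rightarrow> nat" where
  "nchildren l k = card (children l k)"

lemma finite_children [simp]: "finite (children l k)"
  by (rule finite_subset[of _ "{k - int (l k)..<k}"]) (auto simp: children_def)

lemma children_unique:
  assumes "j \<in> children l k" "j \<in> children l k'"
  shows "k = k'"
proof -
  have "\<not> a < b" if "j \<in> children l a" "j \<in> children l b" for a b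
    using that by (auto simp: children_def not_less dest!: spec[of _ a])
  then show ?thesis using assms by (meson linorder_less_linear)
qed

lemma children_shift:
  assumes "periodic d l"
  shows "j + int d * m \<in> children l (k + int d * m) \<longleftrightarrow> j \<in> children l k"
proof -
  have "(\<forall>i. j + int d * m < i \<and> i < k + int d * m \<longrightarrow> j + int d * m < i - int (l i)) \<longleftrightarrow>
        (\<forall>i. j < i \<and> i < k \<longrightarrow> j < i - int (l i))" (is "?L = ?R")
  proof
    assume L: ?L
    show ?R
    proof (intro allI impI)
      fix i assume "j < i \<and> i < k"
      then show "j < i - int (l i)"
        using L[rule_format, of "i + int d * m"] periodic_mult[OF assms, of i m] by simp
    qed
  next
    assume R: ?R
    show ?L
    proof (intro allI impI)
      fix i assume "j + int d * m < i \<and> i < k + int d * m"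
      then show "j + int d * m < i - int (l i)"
        using R[rule_format, of "i - int d * m"] periodic_mult[OF assms, of "i - int d * m" m] by simp
    qed
  qed
  then show ?thesis
    using periodic_mult[OF assms, of k m] by (simp add: children_def)
qed

lemma periodic_nchildren:
  assumes "periodic d l"
  shows "periodic d (nchildren l)"
proof -
  have "nchildren l (k + int d) = nchildren l k" for k
  proof -
    have "bij_betw (\<lambda>j. j + int d) (children l k) (children l (k + int d))"
    proof (rule bij_betwI[where g = "\<lambda>j. j - int d"])
      show "(\<lambda>j. j + int d) \<in> children l k \<rightarrow> children l (k + int d)"
        using children_shift[OF assms, of _ 1 k] by simp
      show "(\<lambda>j. j - int d) \<in> children l (k + int d) \<rightarrow> children l k"
        using children_shift[OF assms, of "_ - int d" 1 k] by simp
    qed simp_all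
    then show ?thesis
      by (simp add: nchildren_def bij_betw_same_card)
  qed
  then show ?thesis by (simp add: periodic_def)
qed

text \<open>No position has two parents, and shifting a position by a multiple of \<open>d\<close>
  shifts its parent equally. So the children of the indices in one period have distinct residues
  modulo \<open>d\<close>.\<close>

lemma sum_nchildren_le:
  assumes per: "periodic d l" and d: "0 < d"
  shows "(\<Sum>k\<in>{0..<int d}. nchildren l k) \<le> d"
proof -
  let ?S = "Sigma {0..<int d} (children l)"
  have "(\<Sum>k\<in>{0..<int d}. nchildren l k) = card ?S"
    by (simp add: nchildren_def)
  also have "\<dots> \<le> card {0..<int d}"
  proof (rule card_inj_on_le)
    show "inj_on (\<lambda>(k, j). j mod int d) ?S"
    proof (rule inj_onI, clarify)
      fix k j k' j'
      assume k: "k \<in> {0..<int d}" and k': "k' \<in> {0..<int d}"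
        and j: "j \<in> children l k" and j': "j' \<in> children l k'"
        and eq: "j mod int d = j' mod int d"
      from eq obtain m where m: "j' = j + int d * m"
        by (metis mod_eqE)
      have "j' \<in> children l (k + int d * m)"
        using children_shift[OF per] j m by blast
      then have k'_eq: "k' = k + int d * m"
        using j' children_unique by blast
      have "k' mod int d = k mod int d"
        by (simp add: k'_eq)
      then have "k' = k"
        using k k' by simp
      then show "k = k' \<and> j = j'"
        using m k'_eq by simp
    qed
    show "(\<lambda>(k, j). j mod int d) ` ?S \<subseteq> {0..<int d}"
      using d by auto
  qed simp
  finally show ?thesis by simp
qed

text \<open>The position just before the shorter block becomes an additional child.\<close>
lemma nchildren_less:
  assumes l: "l \<in> laminar n" and l': "l' \<in> laminar n"
    and less: "l k < l' k" and agree: "\<And>i. l i < l k \<Longrightarrow> l' i = l i"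
  shows "nchildren l k < nchildren l' k"
proof -
  let ?p = "k - int (l k) - 1"
  have ln: "l k < n"
    using less l' by (auto simp: laminar_def intro: less_le_trans)
  \<comment> \<open>By laminarity the blocks of positions inside the block of \<open>k\<close> stay
    inside it. They are shorter than \<open>l k\<close>, so \<open>l'\<close> has the same ones, and
    none of them covers \<open>?p\<close>.\<close>
  have inside: "?p < i - int (l i) \<and> l' i = l i" if "?p < i" "i < k" for i
  proof -
    define t where "t = nat (k - i)"
    have t: "0 < t" "t \<le> l k" "i = k - int t" using that by (auto simp: t_def)
    with l ln have "l i + t \<le> l k" by (auto simp: laminar_def)
    with t agree[of i] show ?thesis by auto
  qed
  have "insert ?p (children l k) \<subseteq> children l' k"
  proof (intro insert_subsetI subsetI)
    show "?p \<in> children l' k"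
      using less inside by (auto simp: children_def)
    fix j assume j: "j \<in> children l k"
    show "j \<in> children l' k"
      using j less inside by (auto simp: children_def)
  qed
  moreover have "?p \<notin> children l k" by (simp add: children_def)
  ultimately show ?thesis
    using card_mono[of "children l' k" "insert ?p (children l k)"] by (simp add: nchildren_def)
qed

text \<open>Among the positions where two sequences differ, take one at which the smaller of the two
  values is least. Below that value the sequences agree, so \<open>nchildren_less\<close> separates
  their counts there.\<close>

lemma inj_on_nchildren: "inj_on nchildren (laminar n)"
proof (rule inj_onI, rule ccontr)
  fix l l' assume l: "l \<in> laminar n" and l': "l' \<in> laminar n"
    and eq: "nchildren l = nchildren l'" and "l \<noteq> l'"
  then obtain k0 where "l k0 \<noteq> l' k0" by blast
  then obtain k where k: "l k \<noteq> l' k"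
    and min: "\<And>i. l i \<noteq> l' i \<Longrightarrow> min (l k) (l' k) \<le> min (l i) (l' i)"
    using ex_has_least_nat[of "\<lambda>k. l k \<noteq> l' k" k0 "\<lambda>k. min (l k) (l' k)"] by blast
  consider "l k < l' k" | "l' k < l k" using k by linarith
  then show False
  proof cases
    case 1
    then have "l' i = l i" if "l i < l k" for i
      using min[of i] that by fastforce
    from nchildren_less[OF l l' 1 this] eq show False by simp
  next
    case 2
    then have "l i = l' i" if "l' i < l' k" for i
      using min[of i] that by fastforce
    from nchildren_less[OF l' l 2 this] eq show False by simp
  qed
qed

section \<open>Height paths and their blocks\<close>

lemma ex_int_antidifference:
  fixes f :: "int \<Rightarrow> int"
  obtains h where "\<And>k. h k = h (k - 1) + f k"
proof
  define h where "h k = (if 0 \<le> k then \<Sum>i\<in>{1..k}. f i else - (\<Sum>i\<in>{k+1..0}. f i))" for k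
  fix k :: int
  consider "k \<ge> 1" | "k = 0" | "k < 0" by linarith
  then show "h k = h (k - 1) + f k"
  proof cases
    case 1
    then have "{1..k} = insert k {1..k-1}" by auto
    then show ?thesis using 1 by (simp add: h_def)
  next
    case 3
    then have "{k..0} = insert k {k+1..0}" by auto
    then show ?thesis using 3 by (simp add: h_def)
  qed (simp add: h_def)
qed

lemma height_shift:
  fixes h :: "int \<Rightarrow> int"
  assumes h: "\<And>k. h k = h (k - 1) + 1 - int (r k)" and per: "periodic d r"
  shows "h (k + int d) = h k + int d - int (\<Sum>i\<in>{0..<int d}. r i)"
proof -
  have step: "h (k + int d) - h k = h (k - 1 + int d) - h (k - 1)" for k
    using h[of "k + int d"] h[of k] periodicD[OF per, of k] by (simp add: algebra_simps)
  \<comment> \<open>The base point -1 is chosen because the steps leading from -1 to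
    \<open>d - 1\<close> are those with indices in \<open>{0..<d}\<close>.\<close>
  have const: "h (k + int d) - h k = h (-1 + int d) - h (-1)" for k
  proof (induction k rule: int_induct[where k = "-1"])
    case (step1 i) then show ?case using step[of "i + 1"] by simp
  next
    case (step2 i) then show ?case using step[of i] by simp
  qed simp
  have "h (int m - 1) - h (-1) = int m - int (\<Sum>i\<in>{0..<int m}. r i)" for m
  proof (induction m)
    case (Suc m)
    have "{0..<1 + int m} = insert (int m) {0..<int m}" by auto
    then show ?case using Suc h[of "int m"] by simp
  qed simp
  from this[of d] const[of k] show ?thesis by (simp add: algebra_simps)
qed

text \<open>The number of positions directly before \<open>k\<close> that are not strictly lower
  than \<open>k\<close>, cut off at \<open>n\<close>. The disjunct \<open>i = n\<close> is the
  cut-off and also ensures that the least value exists.\<close>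

definition nearest_smaller :: "nat \<Rightarrow> (int \<Rightarrow> int) \<Rightarrow> int \<Rightarrow> nat" where
  "nearest_smaller n h k = (LEAST i. i = n \<or> h (k - 1 - int i) < h k)"

lemma nearest_smaller_le: "nearest_smaller n h k \<le> n"
  unfolding nearest_smaller_def by (rule Least_le) simp

lemma nearest_smaller_leI: "h (k - 1 - int i) < h k \<Longrightarrow> nearest_smaller n h k \<le> i"
  unfolding nearest_smaller_def by (rule Least_le) simp

lemma nearest_smaller_less:
  assumes "nearest_smaller n h k < n"
  shows "h (k - 1 - int (nearest_smaller n h k)) < h k"
  using LeastI[of "\<lambda>i. i = n \<or> h (k - 1 - int i) < h k" n] assms
  unfolding nearest_smaller_def[symmetric] by simp

lemma nearest_smaller_ge: "i < nearest_smaller n h k \<Longrightarrow> h k \<le> h (k - 1 - int i)"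
  using not_less_Least[of i "\<lambda>i. i = n \<or> h (k - 1 - int i) < h k"]
  unfolding nearest_smaller_def[symmetric] by simp

text \<open>A position in the block of \<open>k\<close> is at least as high as \<open>k\<close>, so
  the lower position that ends the block of \<open>k\<close> ends its block too, unless an earlier
  one does.\<close>

lemma nearest_smaller_laminar: "nearest_smaller n h \<in> laminar n"
proof -
  have "nearest_smaller n h (k - int i) + i \<le> nearest_smaller n h k"
    if ln: "nearest_smaller n h k < n" and i: "0 < i" "i \<le> nearest_smaller n h k" for k i
  proof -
    let ?l = "nearest_smaller n h k"
    have "h (k - int i) \<ge> h k"
      using nearest_smaller_ge[of "i - 1" n h k] i by (simp add: of_nat_diff)
    moreover have "k - int i - 1 - int (?l - i) = k - 1 - int ?l"
      using i by (simp add: of_nat_diff)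
    ultimately have "h (k - int i - 1 - int (?l - i)) < h (k - int i)"
      using nearest_smaller_less[OF ln] by (metis order_less_le_trans)
    from nearest_smaller_leI[where n = n and h = h, OF this] show ?thesis
      using i by simp
  qed
  then show ?thesis by (auto simp: laminar_def nearest_smaller_le)
qed

text \<open>The heights of the children of \<open>k\<close> are exactly the levels from
  \<open>h k\<close> to \<open>h (k - 1)\<close>, each taken once, and there are \<open>r k\<close>
  such levels.\<close>

lemma nchildren_nearest_smaller:
  fixes h :: "int \<Rightarrow> int"
  assumes h: "\<And>k. h k = h (k - 1) + 1 - int (r k)"
    and drift: "\<And>k. \<exists>i<n. h (k - 1 - int i) \<le> h k"
  shows "nchildren (nearest_smaller n h) k = r k"
proof -
  let ?l = "nearest_smaller n h"
  have up: "h (i + 1) \<le> h i + 1" for i using h[of "i + 1"] by simp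
  \<comment> \<open>Jump from \<open>i\<close> to the lower position that ends its block. This
    position is not to the left of \<open>j\<close>, since no block between \<open>j\<close> and
    \<open>k\<close> covers \<open>j\<close>; repeating the jump ends at \<open>j\<close>.\<close>
  have low: "h j < h i" if j: "j \<in> children ?l k" and i: "j < i" "i < k" for i j
    using i
  proof (induction "nat (i - j)" arbitrary: i rule: less_induct)
    case less
    have j': "j < i - int (?l i)"
      using j less.prems by (auto simp: children_def)
    have "k - int n \<le> j"
      using j nearest_smaller_le[of n h k] by (auto simp: children_def)
    then have "?l i < n" using j' less.prems by linarith
    then have lt: "h (i - 1 - int (?l i)) < h i" by (rule nearest_smaller_less)
    show ?case
    proof (cases "j = i - 1 - int (?l i)")
      case False
      then have "h j < h (i - 1 - int (?l i))"
        using j' less.prems by (intro less.hyps) auto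
      with lt show ?thesis by simp
    qed (use lt in simp)
  qed
  have "bij_betw h (children ?l k) {h k..h (k - 1)}"
    unfolding bij_betw_def
  proof (intro conjI equalityI subsetI)
    show "inj_on h (children ?l k)"
    proof (rule inj_onI, rule ccontr)
      fix i j assume ij: "i \<in> children ?l k" "j \<in> children ?l k" "h i = h j" "i \<noteq> j"
      then have "i < k" "j < k" by (auto simp: children_def)
      then show False using low[of i j] low[of j i] ij by linarith
    qed
  next
    fix v assume "v \<in> h ` children ?l k"
    then obtain j where j: "j \<in> children ?l k" and v: "v = h j" by blast
    have jk: "j < k" "k - int (?l k) \<le> j" using j by (auto simp: children_def)
    then have "h k \<le> h j"
      using nearest_smaller_ge[of "nat (k - 1 - j)" n h k] by simp
    moreover have "h j \<le> h (k - 1)"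
      using low[OF j, of "k - 1"] jk by (cases "j = k - 1") auto
    ultimately show "v \<in> {h k..h (k - 1)}" using v by simp
  next
    fix v assume v: "v \<in> {h k..h (k - 1)}"
    obtain m where m: "m < n" "h (k - 1 - int m) \<le> v"
      using drift[of k] v by fastforce
    \<comment> \<open>The preimage of \<open>v\<close> is the last position before \<open>k\<close>
      of height at most \<open>v\<close>. Its height is exactly \<open>v\<close> because the path
      rises by at most 1 per step, and \<open>drift\<close> places it within \<open>n\<close>
      positions of \<open>k\<close>.\<close>
    define t where "t = (LEAST t. h (k - 1 - int t) \<le> v)"
    define j where "j = k - 1 - int t"
    have hj: "h j \<le> v"
      using LeastI[of "\<lambda>t. h (k - 1 - int t) \<le> v", OF m(2)] by (simp add: t_def j_def)
    have "t \<le> m" unfolding t_def using m(2) by (rule Least_le)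
    then have t: "t < n" using m(1) by simp
    have above: "v < h i" if "j < i" "i < k" for i
      using not_less_Least[of "nat (k - 1 - i)" "\<lambda>t. h (k - 1 - int t) \<le> v"] that
      by (simp add: t_def[symmetric] j_def not_le)
    have "v \<le> h j"
    proof (cases "t = 0")
      case False
      then show ?thesis using above[of "j + 1"] up[of j] by (simp add: j_def)
    qed (use v in \<open>simp add: j_def\<close>)
    with hj have hj: "h j = v" by simp
    \<comment> \<open>Otherwise the block of \<open>k\<close> would be ended by a position strictly
      lower than \<open>h k\<close>, but from \<open>j\<close> up to \<open>k - 1\<close> all
      heights are at least \<open>v\<close>, hence at least \<open>h k\<close>.\<close>
    have "k - int (?l k) \<le> j"
    proof (rule ccontr)
      assume "\<not> ?thesis"
      then have le: "?l k \<le> t" by (simp add: j_def)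
      then have "h (k - 1 - int (?l k)) < h k"
        using t by (intro nearest_smaller_less) simp
      moreover have "v \<le> h (k - 1 - int (?l k))"
        using le hj above[of "k - 1 - int (?l k)"] by (cases "?l k = t") (auto simp: j_def)
      ultimately show False using v by simp
    qed
    moreover have "j < i - int (?l i)" if "j < i" "i < k" for i
      using nearest_smaller_leI[of h i "nat (i - 1 - j)" n] above[OF that] that hj by simp
    ultimately have "j \<in> children ?l k"
      by (auto simp: children_def j_def)
    with hj show "v \<in> h ` children ?l k" by blast
  qed
  then have "card (children ?l k) = card {h k..h (k - 1)}"
    by (rule bij_betw_same_card)
  then show ?thesis using h[of k] by (simp add: nchildren_def)
qed

lemma periodic_nearest_smaller:
  assumes "\<And>k. h (k + int d) = h k + c"
  shows "periodic d (nearest_smaller n h)"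
proof -
  have "h (k + int d - 1 - int i) = h (k - 1 - int i) + c" for k i
    using assms[of "k - 1 - int i"] by (simp add: algebra_simps)
  then show ?thesis by (simp add: periodic_def nearest_smaller_def assms)
qed

lemma bij_betw_nchildren:
  assumes d: "0 < d" "d \<le> n"
  shows "bij_betw nchildren {l \<in> laminar n. periodic d l}
    {r. periodic d r \<and> (\<Sum>k\<in>{0..<int d}. r k) \<le> d}"
  unfolding bij_betw_def
proof (intro conjI equalityI subsetI)
  show "inj_on nchildren {l \<in> laminar n. periodic d l}"
    by (rule inj_on_subset[OF inj_on_nchildren]) auto
next
  fix r assume "r \<in> nchildren ` {l \<in> laminar n. periodic d l}"
  then show "r \<in> {r. periodic d r \<and> (\<Sum>k\<in>{0..<int d}. r k) \<le> d}"
    using periodic_nchildren sum_nchildren_le d by auto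
next
  fix r :: "int \<Rightarrow> nat"
  assume "r \<in> {r. periodic d r \<and> (\<Sum>k\<in>{0..<int d}. r k) \<le> d}"
  then have per: "periodic d r" and le: "(\<Sum>k\<in>{0..<int d}. r k) \<le> d" by auto
  obtain h where "\<And>k. h k = h (k - 1) + (1 - int (r k))"
    using ex_int_antidifference[of "\<lambda>k. 1 - int (r k)"] by blast
  then have h: "\<And>k. h k = h (k - 1) + 1 - int (r k)"
    by (metis add_diff_eq)
  define c where "c = int d - int (\<Sum>k\<in>{0..<int d}. r k)"
  have c: "0 \<le> c" using le unfolding c_def by linarith
  have shift: "h (k + int d) = h k + c" for k
    using height_shift[OF h per, of k] by (simp add: c_def)
  \<comment> \<open>As \<open>c\<close> is nonnegative, \<open>h (k - d)\<close> is at most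
    \<open>h k\<close>. The hypothesis \<open>d \<le> n\<close> enters here: it keeps
    \<open>k - d\<close> within the window.\<close>
  have drift: "\<exists>i<n. h (k - 1 - int i) \<le> h k" for k
    using shift[of "k - int d"] c d by (intro exI[of _ "d - 1"]) (simp add: of_nat_diff)
  have "nchildren (nearest_smaller n h) = r"
    using nchildren_nearest_smaller[OF h drift] by blast
  then show "r \<in> nchildren ` {l \<in> laminar n. periodic d l}"
    using periodic_nearest_smaller[of h d c, OF shift] nearest_smaller_laminar by blast
qed

subsection \<open>Walks of 312-avoiding permutations\<close>

lemma length_std [simp]: "length (std xs) = length xs"
  by (simp add: std_def)

text \<open>Counting positions by a negated strict comparison exhibits \<open>std xs\<close> as a
  function of the relation \<open>xs ! i < xs ! j\<close> alone, as \<open>std_eq_iff\<close>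
  needs.\<close>

lemma std_nth:
  assumes "distinct xs" "i < length xs"
  shows "std xs ! i = card {j. j < length xs \<and> \<not> xs ! i < xs ! j}"
proof -
  have "{y \<in> set xs. y \<le> xs ! i} = (!) xs ` {j. j < length xs \<and> \<not> xs ! i < xs ! j}"
    by (auto simp: in_set_conv_nth)
  moreover have "inj_on ((!) xs) {j. j < length xs \<and> \<not> xs ! i < xs ! j}"
    by (rule inj_on_nth) (use assms in auto)
  ultimately show ?thesis using assms(2) by (simp add: std_def card_image)
qed

lemma std_less_iff:
  assumes "i < length xs" "j < length xs"
  shows "std xs ! i < std xs ! j \<longleftrightarrow> xs ! i < xs ! j"
proof -
  have mono: "card {y \<in> set xs. y \<le> a} \<le> card {y \<in> set xs. y \<le> b}" if "a \<le> b" for a b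
    using that by (intro card_mono) auto
  have "card {y \<in> set xs. y \<le> a} < card {y \<in> set xs. y \<le> b}" if "a < b" "b \<in> set xs" for a b
  proof (rule psubset_card_mono)
    show "{y \<in> set xs. y \<le> a} \<subset> {y \<in> set xs. y \<le> b}" 
      using that by (auto simp: set_eq_iff intro!: psubsetI dest!: spec[of _ b])
  qed simp
  with mono show ?thesis using assms by (auto simp: std_def) (meson leD leI)
qed

lemma std_eq_iff:
  assumes "distinct xs" "distinct ys" "length xs = length ys"
  shows "std xs = std ys \<longleftrightarrow>
    (\<forall>i<length xs. \<forall>j<length xs. xs ! i < xs ! j \<longleftrightarrow> ys ! i < ys ! j)"
proof
  assume "std xs = std ys"
  then show "\<forall>i<length xs. \<forall>j<length xs. xs ! i < xs ! j \<longleftrightarrow> ys ! i < ys ! j"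
    using assms(3) by (metis std_less_iff)
next
  assume *: "\<forall>i<length xs. \<forall>j<length xs. xs ! i < xs ! j \<longleftrightarrow> ys ! i < ys ! j"
  show "std xs = std ys"
  proof (rule nth_equalityI)
    fix i assume "i < length (std xs)"
    then have i: "i < length xs" by simp
    then have "{j. j < length xs \<and> \<not> xs ! i < xs ! j} = {j. j < length ys \<and> \<not> ys ! i < ys ! j}"
      using * assms(3) by auto
    then show "std xs ! i = std ys ! i" using assms i by (simp add: std_nth)
  qed (use assms in simp)
qed

lemma std_perm:
  assumes "is_perm m \<sigma>"
  shows "std \<sigma> = \<sigma>"
proof -
  have "card {y \<in> set \<sigma>. y \<le> x} = x" if "x \<in> set \<sigma>" for x
  proof -
    have "{y \<in> set \<sigma>. y \<le> x} = {1..x}" using assms that by (auto simp: is_perm_def)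
    then show ?thesis by simp
  qed
  then show ?thesis by (simp add: std_def map_idI)
qed

lemma S312_length: "\<sigma> \<in> S312 m \<Longrightarrow> length \<sigma> = m"
  and S312_distinct: "\<sigma> \<in> S312 m \<Longrightarrow> distinct \<sigma>"
  and S312_nth: "\<sigma> \<in> S312 m \<Longrightarrow> i < m \<Longrightarrow> 1 \<le> \<sigma> ! i \<and> \<sigma> ! i \<le> m"
  by (auto simp: S312_def is_perm_def dest: nth_mem)

text \<open>A permutation is its own standardization, so its inversions determine it.\<close>

lemma S312_eqI:
  assumes \<sigma>: "\<sigma> \<in> S312 m" and \<tau>: "\<tau> \<in> S312 m"
    and "\<And>i j. i < j \<Longrightarrow> j < m \<Longrightarrow> \<sigma> ! j < \<sigma> ! i \<longleftrightarrow> \<tau> ! j < \<tau> ! i"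
  shows "\<sigma> = \<tau>"
proof -
  note props = S312_length[OF \<sigma>] S312_length[OF \<tau>] S312_distinct[OF \<sigma>] S312_distinct[OF \<tau>]
  have "\<sigma> ! i < \<sigma> ! j \<longleftrightarrow> \<tau> ! i < \<tau> ! j" if "i < m" "j < m" for i j
  proof (cases i j rule: linorder_cases)
    case less
    then have "\<sigma> ! i \<noteq> \<sigma> ! j" "\<tau> ! i \<noteq> \<tau> ! j" using props that by (auto simp: nth_eq_iff_index_eq)
    then show ?thesis using assms(3)[OF less that(2)] by linarith
  qed (use assms(3) that in auto)
  then have "std \<sigma> = std \<tau>" using props by (subst std_eq_iff) auto
  then show ?thesis using \<sigma> \<tau> std_perm by (metis S312_def mem_Collect_eq)
qed

lemma edge_head_eq_tail_iff:
  assumes \<sigma>: "\<sigma> \<in> S312 (n + 1)" and \<tau>: "\<tau> \<in> S312 (n + 1)"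
  shows "edge_head \<sigma> = edge_tail \<tau> \<longleftrightarrow>
    (\<forall>i<n. \<forall>j<n. \<sigma> ! Suc i < \<sigma> ! Suc j \<longleftrightarrow> \<tau> ! i < \<tau> ! j)"
  unfolding edge_head_def edge_tail_def
  using S312_length[OF \<sigma>] S312_length[OF \<tau>] S312_distinct[OF \<sigma>] S312_distinct[OF \<tau>]
  by (subst std_eq_iff) (auto simp: distinct_tl distinct_butlast nth_tl nth_butlast)

text \<open>By avoidance, the entries exceeding the last one occupy the positions directly before it.\<close>
lemma S312_last_less_iff:
  assumes \<sigma>: "\<sigma> \<in> S312 (n + 1)" and j: "j < n"
  shows "\<sigma> ! n < \<sigma> ! j \<longleftrightarrow> n - j \<le> Suc n - \<sigma> ! n"
proof -
  define A where "A = {j. j < n \<and> \<sigma> ! n < \<sigma> ! j}"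
  note len = S312_length[OF \<sigma>]
  have set: "set \<sigma> = {1..Suc n}" using \<sigma> by (simp add: S312_def is_perm_def)
  have "(!) \<sigma> ` A = {\<sigma> ! n<..Suc n}"
  proof (intro equalityI subsetI)
    fix y assume y: "y \<in> {\<sigma> ! n<..Suc n}"
    then have "y \<in> set \<sigma>" using set by auto
    then obtain i where "i < Suc n" "\<sigma> ! i = y" using len by (auto simp: in_set_conv_nth)
    with y show "y \<in> (!) \<sigma> ` A" by (auto simp: A_def less_Suc_eq)
  qed (use S312_nth[OF \<sigma>] in \<open>auto simp: A_def\<close>)
  moreover have "inj_on ((!) \<sigma>) A"
    by (rule inj_on_nth) (use S312_distinct[OF \<sigma>] len in \<open>auto simp: A_def\<close>)
  ultimately have card: "card A = Suc n - \<sigma> ! n"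
    using card_image by fastforce
  \<comment> \<open>An entry above the last one, followed by an entry below it, forms a 312 with the
    last entry.\<close>
  have up: "b \<in> A" if "a \<in> A" "a \<le> b" "b < n" for a b
  proof (rule ccontr)
    assume "b \<notin> A"
    with that have "a < b" "\<not> \<sigma> ! n < \<sigma> ! b" by (auto simp: A_def le_less)
    moreover have "\<sigma> ! b \<noteq> \<sigma> ! n"
      using S312_distinct[OF \<sigma>] len that by (simp add: nth_eq_iff_index_eq)
    ultimately have "a < b \<and> b < n \<and> n < length \<sigma> \<and> \<sigma> ! b < \<sigma> ! n \<and> \<sigma> ! n < \<sigma> ! a"
      using that len by (auto simp: A_def)
    then have "\<not> avoids312 \<sigma>" unfolding avoids312_def by blast
    then show False using \<sigma> by (simp add: S312_def)
  qed
  show ?thesis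
  proof
    assume "\<sigma> ! n < \<sigma> ! j"
    then have "{j..<n} \<subseteq> A" using up[of j] j by (auto simp: A_def)
    then have "n - j \<le> card A" using card_mono[of A "{j..<n}"] by (simp add: A_def)
    then show "n - j \<le> Suc n - \<sigma> ! n" using card by simp
  next
    assume le: "n - j \<le> Suc n - \<sigma> ! n"
    show "\<sigma> ! n < \<sigma> ! j"
    proof (rule ccontr)
      assume "\<not> ?thesis"
      then have "A \<subseteq> {Suc j..<n}" using up[of _ j] j by (force simp: A_def Suc_le_eq not_le[symmetric])
      then have "card A \<le> n - Suc j" using card_mono[of "{Suc j..<n}" A] by simp
      then show False using card le j by simp
    qed
  qed
qed

section \<open>Bi-infinite walks and their block lengths\<close>

definition walks :: "nat \<Rightarrow> (int \<Rightarrow> nat list) set" where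
  "walks n = {W. \<forall>k. W k \<in> S312 (n + 1) \<and> edge_head (W k) = edge_tail (W (k + 1))}"

text \<open>The window is a permutation of \<open>{1..n+1}\<close>, so this counts the entries that
  exceed its last one: the length of the block before \<open>k\<close>.\<close>

definition reach :: "nat \<Rightarrow> (int \<Rightarrow> nat list) \<Rightarrow> int \<Rightarrow> nat" where
  "reach n W k = Suc n - W k ! n"

text \<open>Entry \<open>i\<close> of \<open>W k\<close> sits at the absolute position
  \<open>k - n + i\<close>. Both sides compare the same two absolute positions, and consecutive
  windows order their overlap alike.\<close>

lemma walks_shift_less_iff:
  assumes W: "W \<in> walks n" and "i + m \<le> n" "j + m \<le> n"
  shows "W k ! i < W k ! j \<longleftrightarrow> W (k - int m) ! (i + m) < W (k - int m) ! (j + m)"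
  using assms(2,3)
proof (induction m)
  case (Suc m)
  have "W (k - int (Suc m)) \<in> S312 (n + 1)" "W (k - int m) \<in> S312 (n + 1)"
    "edge_head (W (k - int (Suc m))) = edge_tail (W (k - int m))"
    using W by (auto simp: walks_def dest!: spec[of _ "k - int (Suc m)"])
  then show ?case using Suc edge_head_eq_tail_iff[of "W (k - int (Suc m))" n "W (k - int m)"]
    by simp
qed simp

text \<open>Sliding the window back by \<open>n - j\<close> makes entry \<open>j\<close> the last
  one, where \<open>S312_last_less_iff\<close> applies. Thus \<open>reach\<close> determines all
  inversions.\<close>

lemma walks_less_iff:
  assumes W: "W \<in> walks n" and ij: "i < j" "j \<le> n"
  shows "W k ! j < W k ! i \<longleftrightarrow> j - i \<le> reach n W (k + int j - int n)"
proof -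
  have "k + int j - int n = k - int (n - j)" using ij by (simp add: of_nat_diff)
  moreover have "W k ! j < W k ! i \<longleftrightarrow> W (k - int (n - j)) ! n < W (k - int (n - j)) ! (i + (n - j))"
    using walks_shift_less_iff[OF W, of j "n - j" i k] ij by simp
  moreover have "n - (i + (n - j)) = j - i" using ij by simp
  moreover have "W (k - int (n - j)) \<in> S312 (n + 1)" using W by (simp add: walks_def)
  then have "W (k - int (n - j)) ! n < W (k - int (n - j)) ! (i + (n - j)) \<longleftrightarrow>
      n - (i + (n - j)) \<le> Suc n - W (k - int (n - j)) ! n"
    using ij by (intro S312_last_less_iff) auto
  ultimately show ?thesis unfolding reach_def by (simp only:)
qed

lemma inj_on_reach: "inj_on (reach n) (walks n)"
proof (rule inj_onI, rule ext)
  fix W W' k assume W: "W \<in> walks n" and W': "W' \<in> walks n" and eq: "reach n W = reach n W'"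
  show "W k = W' k"
  proof (rule S312_eqI)
    show "W k \<in> S312 (n + 1)" "W' k \<in> S312 (n + 1)" using W W' by (auto simp: walks_def)
    show "W k ! j < W k ! i \<longleftrightarrow> W' k ! j < W' k ! i" if "i < j" "j < n + 1" for i j
      using walks_less_iff[OF W that(1)] walks_less_iff[OF W' that(1)] that eq by simp
  qed
qed

text \<open>The entry at \<open>a\<close>, just before the block of \<open>k\<close>, does not
  exceed the last entry, which lies below every entry of the block. So no block of a position in it
  extends to \<open>a\<close>.\<close>

lemma reach_laminar:
  assumes W: "W \<in> walks n"
  shows "reach n W \<in> laminar n"
proof -
  have S: "W k \<in> S312 (n + 1)" for k using W by (simp add: walks_def)
  have "reach n W (k - int i) + i \<le> reach n W k"
    if ln: "reach n W k < n" and i: "0 < i" "i \<le> reach n W k" for k i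
  proof -
    let ?l = "reach n W k"
    define a where "a = n - Suc ?l"
    have a: "a < n - i" using ln i by (simp add: a_def)
    have "W k ! n < W k ! (n - i)"
      using walks_less_iff[OF W, of "n - i" n k] ln i by simp
    moreover have "\<not> W k ! n < W k ! a"
      using walks_less_iff[OF W, of a n k] ln by (simp add: a_def)
    ultimately have "\<not> W k ! (n - i) < W k ! a" by simp
    moreover have "k + int (n - i) - int n = k - int i"
      using ln i by (simp add: of_nat_diff)
    ultimately have "\<not> n - i - a \<le> reach n W (k - int i)"
      using walks_less_iff[OF W, of a "n - i" k] a by simp
    then show ?thesis using ln i by (simp add: a_def)
  qed
  moreover have "reach n W k \<le> n" for k
    using S312_nth[OF S[of k], of n] by (auto simp: reach_def)
  ultimately show ?thesis by (auto simp: laminar_def)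
qed

text \<open>The order that \<open>walks_less_iff\<close> forces on the entries of the window at
  \<open>k\<close>, with \<open>l\<close> in place of \<open>reach\<close>: the first disjunct
  describes non-inversions, the second inversions.\<close>

definition window_less :: "nat \<Rightarrow> (int \<Rightarrow> nat) \<Rightarrow> int \<Rightarrow> nat \<Rightarrow> nat \<Rightarrow> bool" where
  "window_less n l k i j \<longleftrightarrow>
     (i < j \<and> l (k + int j - int n) < j - i) \<or> (j < i \<and> i - j \<le> l (k + int i - int n))"

lemma window_less_linear:
  "window_less n l k i j \<or> i = j \<or> window_less n l k j i"
  "window_less n l k i j \<Longrightarrow> \<not> window_less n l k j i"
  by (auto simp: window_less_def)

text \<open>Laminarity makes inversions transitive (\<open>inv_trans\<close>). The remaining
  arrangements of \<open>a\<close>, \<open>b\<close>, \<open>c\<close> follow from its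
  contrapositive or because blocks are intervals.\<close>

lemma window_less_trans:
  assumes l: "l \<in> laminar n" and n: "a \<le> n" "b \<le> n" "c \<le> n"
    and ab: "window_less n l k a b" and bc: "window_less n l k b c"
  shows "window_less n l k a c"
proof -
  let ?l = "\<lambda>j. l (k + int j - int n)"
  have lam: "?l j + (m - j) \<le> ?l m" if "j < m" "m \<le> n" "m - j \<le> ?l m" "?l m < n" for j m
  proof -
    have "k + int m - int n - int (m - j) = k + int j - int n"
      using that by (simp add: of_nat_diff)
    moreover have "0 < m - j" using that by simp
    then have "l (k + int m - int n - int (m - j)) + (m - j) \<le> ?l m"
      using l that unfolding laminar_def by blast
    ultimately show ?thesis by (simp only:)
  qed
  \<comment> \<open>If \<open>?l m = n\<close>, the block of \<open>m\<close> covers everything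
    before it in the window and no nesting is required.\<close>
  have inv_trans: "m - i \<le> ?l m" if "i < j" "j < m" "m \<le> n" "j - i \<le> ?l j" "m - j \<le> ?l m" for i j m
    using lam[of j m] that by (cases "?l m < n") auto
  consider "a < b" "b < c" | "a < c" "c < b" | "b < a" "a < c" | "b < c" "c < a" | "c < a" "a < b"
    | "c < b" "b < a" | "a = c"
    using ab bc by (auto simp: window_less_def) linarith
  then show ?thesis
    using ab bc n inv_trans[of c b a] inv_trans[of a c b] inv_trans[of b a c]
    by cases (auto simp: window_less_def not_le[symmetric])
qed

text \<open>Each entry is its rank, counted as in \<open>std_nth\<close>. Ranks start at 1, since an
  index is never below itself.\<close>

definition window :: "nat \<Rightarrow> (int \<Rightarrow> nat) \<Rightarrow> int \<Rightarrow> nat list" where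
  "window n l k = map (\<lambda>i. card {j. j \<le> n \<and> \<not> window_less n l k i j}) [0..<Suc n]"

lemma window_nth: "i \<le> n \<Longrightarrow> window n l k ! i = card {j. j \<le> n \<and> \<not> window_less n l k i j}"
  by (simp add: window_def del: upt_Suc)

lemma window_nth_less:
  assumes l: "l \<in> laminar n" and n: "i \<le> n" "j \<le> n"
  shows "window n l k ! i < window n l k ! j \<longleftrightarrow> window_less n l k i j"
proof -
  have *: "window n l k ! i < window n l k ! j"
    if ij: "i \<le> n" "j \<le> n" "window_less n l k i j" for i j
    unfolding window_nth[OF ij(1)] window_nth[OF ij(2)]
  proof (rule psubset_card_mono)
    show "{m. m \<le> n \<and> \<not> window_less n l k i m} \<subset> {m. m \<le> n \<and> \<not> window_less n l k j m}"
    proof (intro psubsetI subsetI)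
      fix m assume "m \<in> {m. m \<le> n \<and> \<not> window_less n l k i m}"
      then show "m \<in> {m. m \<le> n \<and> \<not> window_less n l k j m}"
        using window_less_trans[OF l ij(1,2) _ ij(3)] by auto
    next
      have "j \<in> {m. m \<le> n \<and> \<not> window_less n l k j m}"
        using ij by (simp add: window_less_def)
      then show "{m. m \<le> n \<and> \<not> window_less n l k i m} \<noteq> {m. m \<le> n \<and> \<not> window_less n l k j m}"
        using ij by auto
    qed
  qed simp
  show ?thesis
    using *[OF n] *[OF n(2,1)] window_less_linear[of n l k i j] by fastforce
qed

lemma window_S312:
  assumes l: "l \<in> laminar n"
  shows "window n l k \<in> S312 (n + 1)"
proof -
  let ?w = "window n l k"
  have len: "length ?w = Suc n" by (simp add: window_def)
  have dist: "distinct ?w"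
    unfolding distinct_conv_nth len
  proof (intro allI impI)
    fix i j assume "i < Suc n" "j < Suc n" "i \<noteq> j"
    then show "?w ! i \<noteq> ?w ! j"
      using window_nth_less[OF l, of i j k] window_nth_less[OF l, of j i k]
        window_less_linear(1)[of n l k i j] by auto
  qed
  have "?w ! i \<in> {1..Suc n}" if "i \<le> n" for i
  proof -
    have "card {i} \<le> ?w ! i"
      unfolding window_nth[OF that] using that by (intro card_mono) (auto simp: window_less_def)
    moreover have "?w ! i \<le> card {..n}"
      unfolding window_nth[OF that] by (intro card_mono) auto
    ultimately show ?thesis by simp
  qed
  then have "set ?w \<subseteq> {1..Suc n}" using len by (auto simp: in_set_conv_nth less_Suc_eq_le)
  then have "set ?w = {1..Suc n}"
    using distinct_card[OF dist] len by (intro card_subset_eq) auto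
  moreover have "avoids312 ?w"
    unfolding avoids312_def
  proof clarify
    \<comment> \<open>A 312 here would put \<open>i\<close> into the block of \<open>m\<close> but
      leave out \<open>j\<close>, which is closer to \<open>m\<close>.\<close>
    fix i j m assume a: "i < j" "j < m" "m < length ?w" "?w ! j < ?w ! m" "?w ! m < ?w ! i"
    then have "window_less n l k j m" "window_less n l k m i"
      using window_nth_less[OF l] len by auto
    then show False using a by (auto simp: window_less_def)
  qed
  ultimately show ?thesis using len dist by (simp add: S312_def is_perm_def)
qed

text \<open>\<open>window_less\<close> depends only on absolute positions, which consecutive windows
  share on their overlap.\<close>

lemma window_walks:
  assumes l: "l \<in> laminar n"
  shows "window n l \<in> walks n"
proof -
  have "edge_head (window n l k) = edge_tail (window n l (k + 1))" for k
    unfolding edge_head_eq_tail_iff[OF window_S312[OF l] window_S312[OF l]]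
    by (auto simp: window_nth_less[OF l] window_less_def algebra_simps)
  then show ?thesis using window_S312[OF l] by (simp add: walks_def)
qed

lemma reach_window:
  assumes l: "l \<in> laminar n"
  shows "reach n (window n l) = l"
proof
  fix k
  have le: "l k \<le> n" using l by (simp add: laminar_def)
  have "{j. j \<le> n \<and> \<not> window_less n l k n j} = insert n {..<n - l k}"
    by (auto simp: window_less_def)
  then have "window n l k ! n = Suc (n - l k)" by (simp add: window_nth)
  then show "reach n (window n l) k = l k" using le by (simp add: reach_def)
qed

text \<open>A shifted walk is again a walk, so injectivity of \<open>reach\<close> carries
  periodicity back.\<close>

lemma periodic_reach_iff:
  assumes W: "W \<in> walks n"
  shows "periodic d (reach n W) \<longleftrightarrow> periodic d W"
proof
  assume per: "periodic d (reach n W)"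
  let ?W = "\<lambda>k. W (k + int d)"
  have "?W \<in> walks n" using W by (auto simp: walks_def algebra_simps dest: spec[of _ "_ + int d"])
  moreover have "reach n ?W = reach n W" using per by (auto simp: periodic_def reach_def)
  ultimately have "?W = W" using inj_on_reach W by (blast dest: inj_onD)
  then show "periodic d W" by (auto simp: periodic_def dest: fun_cong)
qed (simp add: periodic_def reach_def)

lemma bij_betw_reach:
  "bij_betw (reach n) {W \<in> walks n. periodic d W} {l \<in> laminar n. periodic d l}"
  unfolding bij_betw_def
proof (intro conjI equalityI subsetI)
  show "inj_on (reach n) {W \<in> walks n. periodic d W}"
    by (rule inj_on_subset[OF inj_on_reach]) auto
next
  fix l assume l: "l \<in> {l \<in> laminar n. periodic d l}"
  then have "periodic d (window n l)"
    using periodic_reach_iff[OF window_walks, of l n d] by (simp add: reach_window)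
  then show "l \<in> reach n ` {W \<in> walks n. periodic d W}"
    using l by (intro image_eqI[of _ _ "window n l"]) (simp_all add: reach_window window_walks)
qed (auto simp: reach_laminar periodic_reach_iff)

section \<open>Closed walks as periodic walks\<close>

lemma closed_walks_iff:
  assumes "0 < d"
  shows "ws \<in> closed_walks n d \<longleftrightarrow> length ws = d \<and> unroll ws \<in> walks n"
proof (cases "length ws = d")
  case True
  have nxt: "unroll ws (int i + 1) = (if i + 1 < d then ws ! (i + 1) else ws ! 0)" if "i < d" for i
  proof (cases "i + 1 < d")
    case True': True
    then show ?thesis using unroll_nth[of "i + 1" ws] True by (simp add: add.commute)
  next
    case False
    then have "int i + 1 = int d" using that by simp
    then show ?thesis using False True by (simp add: unroll_def)
  qed
  let ?P = "\<lambda>k. unroll ws k \<in> S312 (n + 1) \<and> edge_head (unroll ws k) = edge_tail (unroll ws (k + 1))"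
  \<comment> \<open>The condition at \<open>k\<close> depends only on \<open>k mod d\<close>, so one
    period suffices; at its last index the successor wraps around to entry 0.\<close>
  have red: "?P k \<longleftrightarrow> ?P (int (nat (k mod int d)))" for k
  proof -
    have "unroll ws (k mod int d) = unroll ws k"
      using periodic_unroll[of ws] True periodic_mod by metis
    moreover have "unroll ws (k mod int d + 1) = unroll ws (k + 1)"
      using True by (simp add: unroll_def mod_simps)
    ultimately show ?thesis using assms by simp
  qed
  have lt: "nat (k mod int d) < d" for k
    using assms by (simp add: nat_less_iff)
  have "unroll ws \<in> walks n \<longleftrightarrow> (\<forall>k. ?P k)" by (simp add: walks_def)
  also have "\<dots> \<longleftrightarrow> (\<forall>i<d. ?P (int i))" using red lt by metis
  also have "\<dots> \<longleftrightarrow> (\<forall>i<d. ws ! i \<in> S312 (n + 1) \<and>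
      edge_head (ws ! i) = edge_tail (if i + 1 < d then ws ! (i + 1) else ws ! 0))"
    by (intro all_cong) (simp add: nxt unroll_nth True)
  also have "\<dots> \<longleftrightarrow> ws \<in> closed_walks n d"
  proof -
    have "i = d - 1" if "i < d" "\<not> i + 1 < d" for i using that by simp
    then show ?thesis
      using True assms unfolding closed_walks_def by (auto simp: less_diff_conv)
  qed
  finally show ?thesis using True by simp
qed (simp add: closed_walks_def)

lemma bij_betw_unroll_closed_walks:
  assumes "0 < d"
  shows "bij_betw unroll (closed_walks n d) {W \<in> walks n. periodic d W}"
proof -
  have "closed_walks n d = {ws. length ws = d \<and> unroll ws \<in> walks n}"
    using closed_walks_iff[OF assms] by blast
  then show ?thesis
    using bij_betw_unroll[OF assms, of "\<lambda>W. W \<in> walks n"] by (simp add: conj_commute)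
qed

lemma card_periodic_walks:
  assumes "0 < d" "d \<le> n"
  shows "card {W \<in> walks n. periodic d W} = (2 * d) choose d"
proof -
  have "card {W \<in> walks n. periodic d W} = card {l \<in> laminar n. periodic d l}"
    by (rule bij_betw_same_card[OF bij_betw_reach])
  also have "\<dots> = card {r :: int \<Rightarrow> nat. periodic d r \<and> (\<Sum>k\<in>{0..<int d}. r k) \<le> d}"
    by (rule bij_betw_same_card[OF bij_betw_nchildren[OF assms]])
  also have "\<dots> = (2 * d) choose d"
    using assms by (simp add: card_periodic_sum_le mult_2)
  finally show ?thesis .
qed

subsection \<open>Moebius inversion\<close>

lemma moebius_prime_mult:
  assumes "prime p" "\<not> p dvd m" "0 < m"
  shows "moebius (p * m) = - moebius m"
proof -
  have "coprime p m" using assms by (simp add: prime_imp_coprime)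
  then have "squarefree (p * m) \<longleftrightarrow> squarefree m"
    using assms squarefree_mult_coprime squarefree_prime squarefree_multD by blast
  moreover have "prime_factors (p * m) = insert p (prime_factors m)"
    using assms by (subst prime_factors_product) (auto simp: prime_prime_factors)
  moreover have "p \<notin> prime_factors m" using assms by auto
  ultimately show ?thesis by (simp add: moebius_def)
qed

text \<open>For a prime \<open>p\<close> dividing \<open>n\<close>, the squarefree divisors pair up
  as \<open>e\<close> and \<open>p * e\<close> with opposite signs.\<close>

lemma sum_moebius_dvd:
  assumes "0 < n"
  shows "(\<Sum>e | e dvd n. moebius e) = (if n = 1 then 1 else 0)"
proof (cases "n = 1")
  case False
  then obtain p where p: "prime p" "p dvd n" using prime_factor_nat by blast
  let ?A = "{e. e dvd n \<and> squarefree e \<and> \<not> p dvd e}" and ?B = "{e. e dvd n \<and> squarefree e \<and> p dvd e}"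
  have fin: "finite {e. e dvd n}" using assms by simp
  have "(\<Sum>e | e dvd n. moebius e) = (\<Sum>e\<in>?A \<union> ?B. moebius e)"
    using fin by (intro sum.mono_neutral_right) (auto simp: moebius_def)
  also have "\<dots> = (\<Sum>e\<in>?A. moebius e) + (\<Sum>e\<in>?B. moebius e)"
    by (rule sum.union_disjoint) (auto intro: finite_subset[OF _ fin])
  also have "(\<Sum>e\<in>?B. moebius e) = (\<Sum>e\<in>?A. moebius (p * e))"
  proof (rule sum.reindex_bij_betw[symmetric])
    show "bij_betw ((*) p) ?A ?B"
    proof (rule bij_betwI[where g = "\<lambda>e. e div p"])
      show "(*) p \<in> ?A \<rightarrow> ?B"
        using p by (auto simp: prime_imp_coprime divides_mult squarefree_mult_coprime squarefree_prime)
      show "(\<lambda>e. e div p) \<in> ?B \<rightarrow> ?A"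
      proof 
        fix e assume "e \<in> ?B"
        then obtain f where f: "e = p * f" "squarefree (p * f)" "p * f dvd n" by auto
        have "\<not> p dvd f"
        proof
          assume "p dvd f"
          then have "p\<^sup>2 dvd p * f" by (simp add: power2_eq_square)
          then show False using f(2) p(1) squarefreeD not_prime_unit by blast
        qed
        moreover have "squarefree f" using f(2) squarefree_multD by blast
        ultimately show "e div p \<in> ?A" using f p(1) by (auto simp: prime_gt_0_nat dest: dvd_mult_right)
      qed
    qed (use p in \<open>auto simp: prime_gt_0_nat\<close>)
  qed
  also have "\<dots> = (\<Sum>e\<in>?A. - moebius e)"
    using assms by (intro sum.cong moebius_prime_mult p) (auto intro: Nat.gr0I)
  finally show ?thesis using False by (simp add: sum_negf)
qed (simp add: moebius_def)

text \<open>Exchanging the sums leaves, for each \<open>c\<close>, the sum of \<open>moebius\<close>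
  over the divisors of \<open>d div c\<close>, which vanishes unless \<open>c = d\<close>. The
  hypothesis concerns divisors of \<open>d\<close> only, because walks are counted only for periods
  up to \<open>n\<close>.\<close>

lemma moebius_inversion:
  fixes F G :: "nat \<Rightarrow> int"
  assumes d: "0 < d" and F: "\<And>e. e dvd d \<Longrightarrow> F e = (\<Sum>c | c dvd e. G c)"
  shows "(\<Sum>e | e dvd d. moebius (d div e) * F e) = G d"
proof -
  have fin: "finite {e. e dvd d}" using d by simp
  have "(\<Sum>e | e dvd d. moebius (d div e) * F e) =
      (\<Sum>e | e dvd d. \<Sum>c | c dvd d \<and> c dvd e. moebius (d div e) * G c)"
    by (intro sum.cong) (auto simp: F sum_distrib_left intro!: sum.cong intro: dvd_trans)
  also have "\<dots> = (\<Sum>c | c dvd d. \<Sum>e | e dvd d \<and> c dvd e. moebius (d div e) * G c)"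
    using sum.swap_restrict[OF fin fin, of "\<lambda>e c. moebius (d div e) * G c" "\<lambda>e c. c dvd e"] by simp
  also have "\<dots> = (\<Sum>c | c dvd d. if c = d then G c else 0)"
  proof (rule sum.cong)
    fix c assume "c \<in> {c. c dvd d}"
    then obtain m where m: "d = c * m" by auto
    then have pos: "0 < c" "0 < m" using d by auto
    \<comment> \<open>Taking \<open>e\<close> to \<open>d div e\<close> maps the multiples of
      \<open>c\<close> that divide \<open>d\<close> onto the divisors of \<open>m\<close>.\<close>
    have "(\<Sum>e | e dvd d \<and> c dvd e. moebius (d div e)) = (\<Sum>t | t dvd m. moebius t)"
    proof (rule sum.reindex_bij_witness[where i = "\<lambda>t. d div t" and j = "\<lambda>e. d div e"])
    qed (use m pos in \<open>auto elim!: dvdE\<close>)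
    then show "(\<Sum>e | e dvd d \<and> c dvd e. moebius (d div e) * G c) = (if c = d then G c else 0)"
      using m pos by (auto simp: sum_distrib_right[symmetric] sum_moebius_dvd)
  qed simp
  also have "\<dots> = G d" using fin by simp
  finally show ?thesis .
qed

subsection \<open>Shift classes\<close>

lemma shift_class_eq_image:
  assumes "ws \<noteq> []"
  shows "shift_class ws = (\<lambda>k. rotate k ws) ` {..<length ws}"
proof -
  have "rotate k ws \<in> (\<lambda>k. rotate k ws) ` {..<length ws}" for k
    using assms by (subst rotate_conv_mod) auto
  then show ?thesis by (auto simp: shift_class_def)
qed

lemma unroll_rotate:
  assumes "ws \<noteq> []"
  shows "unroll (rotate m ws) k = unroll ws (k + int m)"
proof -
  have "nat (k mod int (length ws)) < length ws" using assms by (simp add: nat_less_iff)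
  moreover have "int ((m + nat (k mod int (length ws))) mod length ws) = (k + int m) mod int (length ws)"
    using assms by (simp add: zmod_int mod_simps add.commute)
  then have "(m + nat (k mod int (length ws))) mod length ws = nat ((k + int m) mod int (length ws))"
    by (metis nat_int)
  ultimately show ?thesis by (simp add: unroll_def nth_rotate)
qed

lemma unroll_eq_iff:
  assumes "length xs = length ys"
  shows "unroll xs = unroll ys \<longleftrightarrow> xs = ys"
  using assms by (auto intro!: nth_equalityI simp: unroll_nth[symmetric])

text \<open>Two rotations coincide exactly when the difference of their amounts is a period, so all
  \<open>length ws\<close> rotations are distinct exactly when no smaller positive period
  exists.\<close>

lemma card_shift_class_iff:
  assumes "ws \<noteq> []"
  shows "card (shift_class ws) = length ws \<longleftrightarrow> min_period (unroll ws) = length ws"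
proof -
  let ?d = "length ws"
  have d: "0 < ?d" using assms by simp
  have rot: "rotate i ws = rotate j ws \<longleftrightarrow> periodic (j - i) (unroll ws)" if "i \<le> j" for i j
  proof -
    have "rotate i ws = rotate j ws \<longleftrightarrow> (\<forall>k. unroll ws (k + int i) = unroll ws (k + int j))"
      by (simp add: unroll_eq_iff[symmetric] fun_eq_iff unroll_rotate assms)
    also have "\<dots> \<longleftrightarrow> periodic (j - i) (unroll ws)"
    proof
      assume *: "\<forall>k. unroll ws (k + int i) = unroll ws (k + int j)"
      show "periodic (j - i) (unroll ws)"
        unfolding periodic_def using *[rule_format, of "_ - int i"] that
        by (simp add: of_nat_diff algebra_simps)
    next
      assume per: "periodic (j - i) (unroll ws)"
      show "\<forall>k. unroll ws (k + int i) = unroll ws (k + int j)"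
        using that periodicD[OF per, of "_ + int i"] by (simp add: of_nat_diff)
    qed
    finally show ?thesis .
  qed
  have "card (shift_class ws) = ?d \<longleftrightarrow> inj_on (\<lambda>k. rotate k ws) {..<?d}"
    unfolding shift_class_eq_image[OF assms]
    using inj_on_iff_eq_card[of "{..<?d}" "\<lambda>k. rotate k ws"] by simp
  also have "\<dots> \<longleftrightarrow> min_period (unroll ws) = ?d"
  proof
    assume inj: "inj_on (\<lambda>k. rotate k ws) {..<?d}"
    note mp = min_period[OF d periodic_unroll]
    show "min_period (unroll ws) = ?d"
    proof (rule ccontr)
      assume "min_period (unroll ws) \<noteq> ?d"
      then have "min_period (unroll ws) < ?d" using dvd_imp_le[OF mp(3) d] by simp
      then show False using inj_onD[OF inj, of 0 "min_period (unroll ws)"] rot[of 0] mp(1,2) d by simp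
    qed
  next
    assume mp: "min_period (unroll ws) = ?d"
    have "rotate i ws \<noteq> rotate j ws" if "i < j" "j < ?d" for i j
    proof
      assume "rotate i ws = rotate j ws"
      then have "periodic (j - i) (unroll ws)" using rot that by simp
      then have "min_period (unroll ws) \<le> j - i"
        unfolding min_period_def using that by (intro Least_le) simp
      then show False using mp that by simp
    qed
    then show "inj_on (\<lambda>k. rotate k ws) {..<?d}"
      by (intro linorder_inj_onI) auto
  qed
  finally show ?thesis .
qed

lemma shift_class_self: "ws \<in> shift_class ws"
  unfolding shift_class_def using rotate0 by (metis (mono_tags, lifting) id_apply mem_Collect_eq)

lemma shift_class_eq:
  assumes "xs \<in> shift_class ws"
  shows "shift_class xs = shift_class ws"
proof -
  have sub: "shift_class xs \<subseteq> shift_class ws" if "xs \<in> shift_class ws" for xs ws :: "'a list"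
    using that by (auto simp: shift_class_def rotate_rotate)
  obtain k where k: "xs = rotate k ws" using assms by (auto simp: shift_class_def)
  \<comment> \<open>Rotating on to the next suitable multiple of the length undoes a rotation by
    \<open>k\<close>.\<close>
  have "ws = rotate (k * length ws - k) xs"
  proof (cases "ws = []")
    case False
    then have "k * length ws - k + k = k * length ws" by (cases "length ws") auto
    then have "rotate (k * length ws - k) xs = rotate (k * length ws) ws"
      by (simp add: k rotate_rotate)
    also have "\<dots> = ws" by (subst rotate_conv_mod) simp
    finally show ?thesis by simp
  qed (simp add: k)
  then have "ws \<in> shift_class xs" unfolding shift_class_def by blast
  with assms sub show ?thesis by blast
qed

lemma rotate_closed_walks:
  assumes "0 < d" "ws \<in> closed_walks n d"
  shows "rotate m ws \<in> closed_walks n d"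
proof -
  have "ws \<noteq> []" using assms by (auto simp: closed_walks_def)
  then have "unroll (rotate m ws) = (\<lambda>k. unroll ws (k + int m))" by (simp add: fun_eq_iff unroll_rotate)
  moreover have "unroll ws \<in> walks n" using assms closed_walks_iff by blast
  ultimately have "unroll (rotate m ws) \<in> walks n"
    by (auto simp: walks_def algebra_simps dest: spec[of _ "_ + int m"])
  then show ?thesis using assms closed_walks_iff by (metis length_rotate)
qed

text \<open>The \<open>d\<close>-cycles partition the closed walks of least period \<open>d\<close>
  into classes of size \<open>d\<close>, and \<open>unroll\<close> identifies these walks with
  periodic ones.\<close>

lemma card_d_cycles:
  assumes d: "0 < d" and fin: "finite (closed_walks n d)"
  shows "d * card (d_cycles n d) = card {W \<in> walks n. periodic d W \<and> min_period W = d}"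
proof -
  define P where "P = {ws \<in> closed_walks n d. min_period (unroll ws) = d}"
  have len: "length ws = d" if "ws \<in> closed_walks n d" for ws
    using that by (simp add: closed_walks_def)
  have prim: "card (shift_class ws) = d \<longleftrightarrow> min_period (unroll ws) = d" if "ws \<in> closed_walks n d" for ws
    using card_shift_class_iff[of ws] len[OF that] d by fastforce
  have union: "\<Union> (d_cycles n d) = P"
  proof (intro equalityI subsetI)
    fix xs assume "xs \<in> \<Union> (d_cycles n d)"
    then obtain ws where ws: "ws \<in> closed_walks n d" "card (shift_class ws) = d" "xs \<in> shift_class ws"
      by (auto simp: d_cycles_def)
    then have "xs \<in> closed_walks n d"
      using rotate_closed_walks[OF d ws(1)] by (auto simp: shift_class_def)
    then show "xs \<in> P" using ws(2) shift_class_eq[OF ws(3)] prim[of xs] by (simp add: P_def)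
  next
    fix ws assume "ws \<in> P"
    then show "ws \<in> \<Union> (d_cycles n d)"
      using shift_class_self prim by (auto simp: P_def d_cycles_def)
  qed
  have finP: "finite P" using fin by (simp add: P_def)
  have "d * card (d_cycles n d) = card (\<Union> (d_cycles n d))"
  proof (rule card_partition)
    show "finite (\<Union> (d_cycles n d))" using finP union by simp
    then show "finite (d_cycles n d)" by (rule finite_UnionD)
    show "c1 \<inter> c2 = {}" if "c1 \<in> d_cycles n d" "c2 \<in> d_cycles n d" "c1 \<noteq> c2" for c1 c2
    proof (rule ccontr)
      assume "c1 \<inter> c2 \<noteq> {}"
      then obtain xs where xs: "xs \<in> c1" "xs \<in> c2" by blast
      from that obtain u v where "c1 = shift_class u" "c2 = shift_class v"
        unfolding d_cycles_def by blast
      then show False using xs that(3) shift_class_eq by metis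
    qed
  qed (auto simp: d_cycles_def)
  also have "\<dots> = card P" by (simp add: union)
  also have "\<dots> = card (unroll ` P)"
    by (rule card_image[symmetric], rule inj_onI) (auto simp: P_def len unroll_eq_iff)
  also have "unroll ` P = {W \<in> walks n. periodic d W \<and> min_period W = d}"
    using bij_betw_imp_surj_on[OF bij_betw_unroll_closed_walks[OF d, of n]] by (auto simp: P_def)
  finally show ?thesis .
qed

theorem theorem5p2:
  fixes n d :: nat
  assumes "n \<ge> 1" and "0 < d" and "d \<le> n"
  shows "real (card (d_cycles n d)) =
    (1 / real d) * (\<Sum>e | e dvd d. real_of_int (moebius (d div e)) * real ((2*e) choose e))"
proof -
  let ?F = "\<lambda>e. int ((2 * e) choose e)"
  let ?G = "\<lambda>e. int (card {W \<in> walks n. periodic e W \<and> min_period W = e})"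
  have card: "card {W \<in> walks n. periodic e W} = (2 * e) choose e"
    and fin: "finite {W \<in> walks n. periodic e W}" if "e dvd d" for e
  proof -
    have e: "0 < e" "e \<le> n" using that assms dvd_imp_le[of e d] by (auto intro: Nat.gr0I)
    show "card {W \<in> walks n. periodic e W} = (2 * e) choose e" by (rule card_periodic_walks[OF e])
    \<comment> \<open>An infinite set has cardinality 0, so the positive count already proves
      finiteness.\<close>
    then have "0 < card {W \<in> walks n. periodic e W}" by simp
    then show "finite {W \<in> walks n. periodic e W}" by (rule card_ge_0_finite)
  qed
  have "?F e = (\<Sum>c | c dvd e. ?G c)" if "e dvd d" for e
    using card_periodic_eq_sum_min_period[OF dvd_pos_nat[OF assms(2) that] fin[OF that]] card[OF that]
    by simp
  then have "(\<Sum>e | e dvd d. moebius (d div e) * ?F e) = ?G d"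
    by (intro moebius_inversion assms(2))
  moreover have "finite (closed_walks n d)"
    using bij_betw_finite[OF bij_betw_unroll_closed_walks[OF assms(2)]] fin[OF dvd_refl]
    by (simp only:)
  ultimately have "(\<Sum>e | e dvd d. moebius (d div e) * ?F e) = int (d * card (d_cycles n d))"
    using card_d_cycles[OF assms(2)] by simp
  from arg_cong[OF this, of real_of_int]
  have "(\<Sum>e | e dvd d. real_of_int (moebius (d div e)) * real ((2*e) choose e)) =
      real d * real (card (d_cycles n d))"
    by simp
  then show ?thesis using assms(2) by simp
qed

end
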